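(* Let $\{\beta_n\}_{n\ge 1}$ be a sequence of positive real numbers such that $\lim_{n\to\infty}\beta_n=0$, $\sum_{n}\beta_n/n=\infty$, and the sequence $\{n^{-2}\beta_n\}_{n\ge1}$ is decreasing. Then there exists a bounded operator $F$ on a complex Hilbert space such that $$\|F^n\|\le 1+\sqrt{\beta_n}\quad\text{for all }n\ge 1,$$ but $F$ is not similar to a contraction.
   Context: A bounded operator $F$ on a Hilbert space $H$ is similar to a contraction if there is a bounded invertible operator $S$ on $H$ (with bounded inverse) such that $\|SFS^{-1}\|\le 1$. *)

theory Defs
  imports Complex_Main "HOL-Library.Function_Algebras"
begin

definition hnorm :: "('a \<Rightarrow> 'a \<Rightarrow> complex) \<Rightarrow> 'a \<Rightarrow> real" where
  "hnorm ip x = sqrt (Re (ip x x))"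

text \<open>
  A complex Hilbert space is given by a complex vector space structure \<open>scale\<close> on an ambient
  type, a linear subspace \<open>H\<close> (the underlying set of the Hilbert space) and an inner product on
  \<open>H\<close>, linear in the first argument. The ambient type carries no topology, and the values of
  \<open>ip\<close> outside \<open>H\<close> are irrelevant. By conjugate symmetry \<open>ip x x\<close> is real, so that positivity
  only concerns its real part.
\<close>

locale complex_hilbert_space = vector_space scale
  for scale :: "complex \<Rightarrow> 'a::ab_group_add \<Rightarrow> 'a" +
  fixes H :: "'a set"
    and ip :: "'a \<Rightarrow> 'a \<Rightarrow> complex"
  assumes subspace_H: "subspace H"
    and ip_add: "\<lbrakk>x \<in> H; y \<in> H; z \<in> H\<rbrakk> \<Longrightarrow> ip (x + y) z = ip x z + ip y z"
    and ip_scale: "\<lbrakk>x \<in> H; y \<in> H\<rbrakk> \<Longrightarrow> ip (scale c x) y = c * ip x y"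
    and ip_commute: "\<lbrakk>x \<in> H; y \<in> H\<rbrakk> \<Longrightarrow> ip y x = cnj (ip x y)"
    and ip_pos: "\<lbrakk>x \<in> H; x \<noteq> 0\<rbrakk> \<Longrightarrow> 0 < Re (ip x x)"
    and complete_H:
      "\<lbrakk>\<forall>n. X n \<in> H; \<forall>e>0. \<exists>N. \<forall>m\<ge>N. \<forall>n\<ge>N. hnorm ip (X m - X n) < e\<rbrakk>
        \<Longrightarrow> \<exists>l\<in>H. (\<lambda>n::nat. hnorm ip (X n - l)) \<longlonglongrightarrow> 0"

text \<open>
  Operators on \<open>H\<close> are functions on the ambient type of which only the restriction to \<open>H\<close> matters.
\<close>

definition bounded_operator ::
  "(complex \<Rightarrow> 'a::ab_group_add \<Rightarrow> 'a) \<Rightarrow> 'a set \<Rightarrow> ('a \<Rightarrow> 'a \<Rightarrow> complex) \<Rightarrow> ('a \<Rightarrow> 'a) \<Rightarrow> bool" where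
  "bounded_operator scale H ip F \<longleftrightarrow>
     (\<forall>x\<in>H. F x \<in> H) \<and>
     (\<forall>x\<in>H. \<forall>y\<in>H. F (x + y) = F x + F y) \<and>
     (\<forall>c. \<forall>x\<in>H. F (scale c x) = scale c (F x)) \<and>
     (\<exists>C. \<forall>x\<in>H. hnorm ip (F x) \<le> C * hnorm ip x)"

text \<open>Only meaningful for bounded operators, since \<open>Sup\<close> of an unbounded set of reals is unspecified.\<close>

definition operator_norm :: "'a set \<Rightarrow> ('a \<Rightarrow> 'a \<Rightarrow> complex) \<Rightarrow> ('a \<Rightarrow> 'a) \<Rightarrow> real" where
  "operator_norm H ip F = (SUP x\<in>{x \<in> H. hnorm ip x \<le> 1}. hnorm ip (F x))"

text \<open>In the following definition \<open>T\<close> is the inverse of \<open>S\<close> on \<open>H\<close>.\<close>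

definition similar_to_contraction ::
  "(complex \<Rightarrow> 'a::ab_group_add \<Rightarrow> 'a) \<Rightarrow> 'a set \<Rightarrow> ('a \<Rightarrow> 'a \<Rightarrow> complex) \<Rightarrow> ('a \<Rightarrow> 'a) \<Rightarrow> bool" where
  "similar_to_contraction scale H ip F \<longleftrightarrow>
     (\<exists>S T. bounded_operator scale H ip S \<and> bounded_operator scale H ip T \<and>
        (\<forall>x\<in>H. T (S x) = x \<and> S (T x) = x) \<and>
        operator_norm H ip (S \<circ> F \<circ> T) \<le> 1)"

end

theory Submission
  imports Defs "HOL-Analysis.Convex"
begin

text \<open>
  The operator is a Foguel operator \<open>F (u, w) = (B u + \<Gamma> w, A w)\<close> on the sum of two copies of the space of
  square-summable sequences, where \<open>A\<close> is the shift, \<open>B\<close> the backward shift, and \<open>\<Gamma>\<close> a Hankel matrix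
  with entries \<open>c\<^sub>k\<close> at the places \<open>i + j + 1 = 2^k\<close> and zeros elsewhere. Because \<open>\<Gamma> A = B \<Gamma>\<close>, the power
  \<open>F\<^sup>n\<close> has the same form with corner \<open>n B^(n-1) \<Gamma>\<close>.

  Growth of the powers. Split the matrix \<open>B^(n-1) \<Gamma>\<close> along the diagonal. Two powers of two are too far
  apart for a column of the upper part or a row of the lower part to contain two nonzero entries, and
  therefore the norm is at most twice the Euclidean norm of the \<open>c\<^sub>k\<close> with \<open>2^k \<ge> n\<close>
  (\<open>lacunary_hankel_bound\<close>). For \<open>4 c\<^sub>k\<^sup>2 = b (2^k) - b (2^(k+1))\<close> with \<open>b n = \<beta>\<^sub>n / n\<^sup>2\<close>, monotonicity of \<open>b\<close>
  makes the right-hand side nonnegative and the sum telescopes, so that the corner of \<open>F\<^sup>n\<close> has norm at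
  most \<open>n sqrt (b n) = sqrt \<beta>\<^sub>n\<close> and \<open>F\<^sup>n\<close> has norm at most \<open>1 + sqrt \<beta>\<^sub>n\<close> (\<open>foguel_power_bound\<close>).

  Obstruction to similarity. The first coordinates of the two summands give a vector \<open>e\<close> and a
  functional \<open>f\<close> such that \<open>f (F\<^sup>n e)\<close> is \<open>2^k c\<^sub>k\<close> if \<open>n = 2^k\<close> and zero if \<open>n\<close> is not a power of two.
  If \<open>F\<close> were similar to a contraction, such a lacunary family would be square summable
  (\<open>lacunary_estimate\<close>). This is an operator form of Paley's inequality for lacunary coefficients,
  and is proved with polynomials of Rudin-Shapiro type that have prescribed coefficients at the powers of
  two and stay bounded on contractions. However, the sum of \<open>4^k c\<^sub>k\<^sup>2 = \<beta>(2^k) / 4 - \<beta>(2^(k+1)) / 16\<close> is,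
  up to a bounded term, \<open>3/16\<close> times the sum of \<open>\<beta>(2^k)\<close>, which diverges together with the sum of
  \<open>\<beta>\<^sub>n / n\<close> by Cauchy condensation.
\<close>

section \<open>A lacunary estimate for operators similar to a contraction\<close>

context complex_hilbert_space
begin

lemma zero_in_H: "0 \<in> H"
  using subspace_H by (rule subspace_0)

lemma add_in_H: "x \<in> H \<Longrightarrow> y \<in> H \<Longrightarrow> x + y \<in> H"
  using subspace_H by (rule subspace_add)

lemma scale_in_H: "x \<in> H \<Longrightarrow> scale c x \<in> H"
  using subspace_H by (rule subspace_scale)

lemma diff_in_H: "x \<in> H \<Longrightarrow> y \<in> H \<Longrightarrow> x - y \<in> H"
  using subspace_H by (rule subspace_diff)

lemma ip_zero: "ip 0 0 = 0"
  using ip_scale[OF zero_in_H zero_in_H, of 0] by simp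

lemma Re_ip_nonneg: "x \<in> H \<Longrightarrow> 0 \<le> Re (ip x x)"
  using ip_pos[of x] ip_zero by (cases "x = 0") auto

lemma hnorm_sq: "x \<in> H \<Longrightarrow> (hnorm ip x)\<^sup>2 = Re (ip x x)"
  by (simp add: hnorm_def Re_ip_nonneg)

lemma hnorm_nonneg: "x \<in> H \<Longrightarrow> 0 \<le> hnorm ip x"
  by (simp add: hnorm_def Re_ip_nonneg)

lemma ip_scale_right:
  assumes "x \<in> H" "y \<in> H"
  shows "ip x (scale c y) = cnj c * ip x y"
  using assms ip_commute[of "scale c y" x] ip_commute[of y x] ip_scale[of y x c]
  by (simp add: scale_in_H)

lemma ip_add_right:
  assumes "x \<in> H" "y \<in> H" "z \<in> H"
  shows "ip x (y + z) = ip x y + ip x z"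
  using assms ip_commute[of "y + z" x] ip_commute[of y x] ip_commute[of z x] ip_add[of y z x]
  by (simp add: add_in_H)

lemma hnorm_scale:
  assumes "x \<in> H"
  shows "hnorm ip (scale c x) = cmod c * hnorm ip x"
proof -
  have "ip (scale c x) (scale c x) = of_real ((cmod c)\<^sup>2) * ip x x"
    unfolding complex_norm_square
    using assms by (simp add: ip_scale ip_scale_right scale_in_H mult_ac)
  then have "Re (ip (scale c x) (scale c x)) = (cmod c)\<^sup>2 * Re (ip x x)"
    by simp
  then show ?thesis
    by (simp add: hnorm_def real_sqrt_mult)
qed

lemma hnorm_sq_add_scale:
  assumes "x \<in> H" "y \<in> H"
  shows "(hnorm ip (x + scale (of_real a) y))\<^sup>2
           = (hnorm ip x)\<^sup>2 + 2 * a * Re (ip x y) + a\<^sup>2 * (hnorm ip y)\<^sup>2"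
proof -
  have "Re (ip y x) = Re (ip x y)"
    using ip_commute[OF assms] by simp
  then show ?thesis
    using assms
    by (simp add: hnorm_sq add_in_H scale_in_H ip_add ip_add_right ip_scale ip_scale_right
        algebra_simps) (simp add: power2_eq_square)
qed

text \<open>
  Up to the factor \<open>sqrt (1 + a\<^sup>2)\<close>, the pair \<open>(x + a y, y - a x)\<close> is a rotation of \<open>(x, y)\<close>:
  the two mixed terms cancel because \<open>a\<close> is real.
\<close>
lemma rotation_identity:
  assumes "x \<in> H" "y \<in> H"
  shows "(hnorm ip (x + scale (of_real a) y))\<^sup>2 + (hnorm ip (y - scale (of_real a) x))\<^sup>2
           = (1 + a\<^sup>2) * ((hnorm ip x)\<^sup>2 + (hnorm ip y)\<^sup>2)"
proof -
  have "y - scale (of_real a) x = y + scale (of_real (- a)) x"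
    by simp
  moreover have "Re (ip y x) = Re (ip x y)"
    using ip_commute[OF assms] by simp
  ultimately show ?thesis
    unfolding hnorm_sq_add_scale[OF assms]
    using hnorm_sq_add_scale[OF assms(2,1), of "- a"] by (simp add: algebra_simps)
qed

lemma bounded_operator_powers:
  assumes F: "bounded_operator scale H ip F"
  shows "x \<in> H \<Longrightarrow> (F ^^ n) x \<in> H"
    and "x \<in> H \<Longrightarrow> y \<in> H \<Longrightarrow> (F ^^ n) (x + y) = (F ^^ n) x + (F ^^ n) y"
    and "x \<in> H \<Longrightarrow> (F ^^ n) (scale c x) = scale c ((F ^^ n) x)"
proof -
  have in_H: "(F ^^ n) x \<in> H" if "x \<in> H" for x n
    using F that by (induction n) (auto simp: bounded_operator_def)
  show "x \<in> H \<Longrightarrow> (F ^^ n) x \<in> H"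
    by (rule in_H)
  show "x \<in> H \<Longrightarrow> y \<in> H \<Longrightarrow> (F ^^ n) (x + y) = (F ^^ n) x + (F ^^ n) y"
    using F in_H by (induction n) (auto simp: bounded_operator_def)
  show "x \<in> H \<Longrightarrow> (F ^^ n) (scale c x) = scale c ((F ^^ n) x)"
    using F in_H by (induction n) (auto simp: bounded_operator_def)
qed

lemma bounded_operator_diff:
  assumes F: "bounded_operator scale H ip F" and "x \<in> H" "y \<in> H"
  shows "F (x - y) = F x - F y"
proof -
  have "F (x - y) = F (x + scale (-1) y)"
    by simp
  also have "\<dots> = F x + scale (-1) (F y)"
    using assms scale_in_H[of y "-1"] by (auto simp: bounded_operator_def simp del: scale_minus_left)
  finally show ?thesis
    by simp
qed

lemma bounded_operator_bound:
  assumes "bounded_operator scale H ip F"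
  obtains C where "0 \<le> C" "\<And>x. x \<in> H \<Longrightarrow> hnorm ip (F x) \<le> C * hnorm ip x"
proof -
  obtain C where C: "\<And>x. x \<in> H \<Longrightarrow> hnorm ip (F x) \<le> C * hnorm ip x"
    using assms unfolding bounded_operator_def by blast
  show ?thesis
  proof (rule that[of "\<bar>C\<bar>"])
    fix x assume "x \<in> H"
    then show "hnorm ip (F x) \<le> \<bar>C\<bar> * hnorm ip x"
      using C[of x] mult_right_mono[OF abs_ge_self[of C] hnorm_nonneg[of x]] by linarith
  qed simp
qed

lemma bounded_operator_comp:
  assumes F: "bounded_operator scale H ip F" and G: "bounded_operator scale H ip G"
  shows "bounded_operator scale H ip (F \<circ> G)"
proof -
  obtain C where C: "0 \<le> C" "\<And>x. x \<in> H \<Longrightarrow> hnorm ip (F x) \<le> C * hnorm ip x"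
    using bounded_operator_bound[OF F] by blast
  obtain D where D: "\<And>x. x \<in> H \<Longrightarrow> hnorm ip (G x) \<le> D * hnorm ip x"
    using bounded_operator_bound[OF G] by blast
  have "hnorm ip (F (G x)) \<le> (C * D) * hnorm ip x" if "x \<in> H" for x
  proof -
    have "hnorm ip (F (G x)) \<le> C * hnorm ip (G x)"
      using C(2) G that by (simp add: bounded_operator_def)
    also have "\<dots> \<le> C * (D * hnorm ip x)"
      using C(1) D[OF that] by (intro mult_left_mono)
    finally show ?thesis
      by (simp add: mult_ac)
  qed
  then show ?thesis
    using F G by (auto simp: bounded_operator_def)
qed

text \<open>
  The supremum is taken over the unit ball, so a nonzero vector is normalised first; boundedness of
  \<open>G\<close> is what makes the supremum an upper bound.
\<close>
lemma hnorm_le_of_operator_norm_le_1: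
  assumes G: "bounded_operator scale H ip G" and norm: "operator_norm H ip G \<le> 1" and x: "x \<in> H"
  shows "hnorm ip (G x) \<le> hnorm ip x"
proof (cases "x = 0")
  case True
  obtain C where "hnorm ip (G x) \<le> C * hnorm ip x"
    using bounded_operator_bound[OF G] x by blast
  then show ?thesis
    using True by (simp add: hnorm_def ip_zero)
next
  case False
  define r where "r = hnorm ip x"
  have r: "r > 0"
    using ip_pos[OF x False] by (simp add: r_def hnorm_def)
  define z where "z = scale (of_real (1 / r)) x"
  have z: "z \<in> H"
    by (simp only: z_def scale_in_H[OF x])
  have "hnorm ip z = 1"
    unfolding z_def hnorm_scale[OF x] using r by (simp add: r_def norm_divide)
  then have zm: "z \<in> {x \<in> H. hnorm ip x \<le> 1}"
    using z by simp
  obtain C where C: "0 \<le> C" "\<And>x. x \<in> H \<Longrightarrow> hnorm ip (G x) \<le> C * hnorm ip x"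
    using bounded_operator_bound[OF G] by blast
  have "bdd_above ((\<lambda>x. hnorm ip (G x)) ` {x \<in> H. hnorm ip x \<le> 1})"
  proof (rule bdd_aboveI2)
    fix y assume "y \<in> {x \<in> H. hnorm ip x \<le> 1}"
    then show "hnorm ip (G y) \<le> C"
      using C(2)[of y] mult_left_mono[of "hnorm ip y" 1 C] C(1) by simp
  qed
  from cSUP_upper[OF zm this] have "hnorm ip (G z) \<le> 1"
    using norm by (simp add: operator_norm_def)
  moreover have "G z = scale (of_real (1 / r)) (G x)"
    using G x by (simp only: bounded_operator_def z_def)
  moreover have "G x \<in> H"
    using G x by (simp add: bounded_operator_def)
  ultimately show ?thesis
    using r by (simp add: hnorm_scale norm_divide r_def field_simps)
qed

text \<open>
  The span of \<open>F\<^sup>m u\<close> for \<open>m \<in> M\<close> consists of the vectors \<open>p(F) u\<close> for polynomials \<open>p\<close> with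
  exponents in \<open>M\<close>, and \<open>F\<^sup>s\<close> translates the exponents. Sets of exponents are thus all the
  information on coefficients that is kept in what follows.
\<close>
lemma span_orbit_shift:
  assumes F: "bounded_operator scale H ip F" and u: "u \<in> H"
    and z: "z \<in> span ((\<lambda>m. (F ^^ m) u) ` M)" and N: "\<And>m. m \<in> M \<Longrightarrow> s + m \<in> N"
  shows "z \<in> H" and "(F ^^ s) z \<in> span ((\<lambda>m. (F ^^ m) u) ` N)"
proof -
  have "z \<in> H \<and> (F ^^ s) z \<in> span ((\<lambda>m. (F ^^ m) u) ` N)"
    using z
  proof (induction rule: span_induct_alt)
    case base
    have "(F ^^ s) 0 = 0"
      using bounded_operator_powers(3)[OF F zero_in_H, of s 0] by simp
    then show ?case
      by (simp add: zero_in_H span_zero)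
  next
    case (step c x y)
    then obtain m where m: "m \<in> M" "x = (F ^^ m) u"
      by auto
    have xH: "x \<in> H"
      using m(2) bounded_operator_powers(1)[OF F u] by simp
    have "(F ^^ s) x = (F ^^ (s + m)) u"
      using m(2) by (simp add: funpow_add)
    then have "(F ^^ s) x \<in> span ((\<lambda>m. (F ^^ m) u) ` N)"
      using N[OF m(1)] by (auto intro: span_base)
    then show ?case
      using step xH
      by (simp add: bounded_operator_powers[OF F] scale_in_H add_in_H span_add span_scale)
  qed
  then show "z \<in> H" and "(F ^^ s) z \<in> span ((\<lambda>m. (F ^^ m) u) ` N)"
    by auto
qed

lemma functional_vanishes_on_span_orbit:
  assumes F: "bounded_operator scale H ip F" and u: "u \<in> H"
    and z: "z \<in> span ((\<lambda>m. (F ^^ m) u) ` M)"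
    and add: "\<And>x y. x \<in> H \<Longrightarrow> y \<in> H \<Longrightarrow> f (x + y) = f x + f y"
    and scale: "\<And>c x. x \<in> H \<Longrightarrow> f (scale c x) = c * f x"
    and zero: "\<And>m. m \<in> M \<Longrightarrow> f ((F ^^ m) u) = (0::complex)"
  shows "f z = 0"
proof -
  have "z \<in> H \<and> f z = 0"
    using z
  proof (induction rule: span_induct_alt)
    case base
    show ?case
      using scale[OF zero_in_H, of 0] by (simp add: zero_in_H)
  next
    case (step c x y)
    then show ?case
      using zero bounded_operator_powers(1)[OF F u] by (auto simp: add scale scale_in_H add_in_H)
  qed
  then show ?thesis ..
qed

end

text \<open>
  The vectors \<open>p\<^sub>k(F) u\<close> and \<open>q\<^sub>k(F) u\<close> for the polynomials with \<open>p\<^sub>0 = 0\<close>, \<open>q\<^sub>0 = z\<close> and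
  \<open>p\<^bsub>k+1\<^esub> = p\<^sub>k + a\<^sub>k q\<^sub>k\<close>, \<open>q\<^bsub>k+1\<^esub> = z^(2^k) (q\<^sub>k - a\<^sub>k p\<^sub>k)\<close>, a recursion of Rudin-Shapiro type.
  On the unit circle \<open>|p\<^bsub>k+1\<^esub>|\<^sup>2 + |q\<^bsub>k+1\<^esub>|\<^sup>2 = (1 + a\<^sub>k\<^sup>2) (|p\<^sub>k|\<^sup>2 + |q\<^sub>k|\<^sup>2)\<close>, so that for
  square-summable \<open>a\<close> the \<open>p\<^sub>k\<close> are uniformly bounded there, while their coefficients at the powers of
  two are prescribed.
\<close>
primrec lacunary_pair ::
  "(complex \<Rightarrow> 'a::ab_group_add \<Rightarrow> 'a) \<Rightarrow> ('a \<Rightarrow> 'a) \<Rightarrow> (nat \<Rightarrow> real) \<Rightarrow> 'a \<Rightarrow> nat \<Rightarrow> 'a \<times> 'a" where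
  "lacunary_pair sc F a u 0 = (0, F u)"
| "lacunary_pair sc F a u (Suc k) =
     (fst (lacunary_pair sc F a u k)
        + sc (of_real (a k)) (snd (lacunary_pair sc F a u k)),
      (F ^^ (2 ^ k)) (snd (lacunary_pair sc F a u k)
        - sc (of_real (a k)) (fst (lacunary_pair sc F a u k))))"

context complex_hilbert_space
begin

text \<open>
  The exponents of \<open>p\<^sub>k\<close> lie in \<open>[1, 2^(k-1)]\<close>, while \<open>q\<^sub>k\<close> is \<open>z^(2^k)\<close> plus terms with exponents
  strictly between \<open>2^(k-1)\<close> and \<open>2^k\<close>. Hence the step to \<open>p\<^bsub>k+1\<^esub>\<close> adds \<open>a\<^sub>k z^(2^k)\<close> and no other
  power of two. The bounds are written with \<open>2 * m\<close> to avoid the exponent \<open>k - 1\<close> at \<open>k = 0\<close>.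
\<close>
lemma lacunary_pair_spectrum:
  assumes F: "bounded_operator scale H ip F" and u: "u \<in> H"
  defines "orbit M \<equiv> span ((\<lambda>m. (F ^^ m) u) ` M)"
  shows "fst (lacunary_pair scale F a u k) \<in> orbit {m. 1 \<le> m \<and> 2 * m \<le> 2 ^ k}"
    and "snd (lacunary_pair scale F a u k) - (F ^^ (2 ^ k)) u \<in> orbit {m. 2 ^ k < 2 * m \<and> m < 2 ^ k}"
proof (induction k)
  case 0
  {
    case 1 show ?case by (simp add: orbit_def span_zero)
  next
    case 2 show ?case by (simp add: orbit_def span_zero)
  }
next
  case (Suc k)
  define x where "x = fst (lacunary_pair scale F a u k)"
  define y where "y = snd (lacunary_pair scale F a u k)"
  define e where "e = (F ^^ (2 ^ k)) u"
  have mono: "z \<in> orbit N" if "z \<in> orbit M" "M \<subseteq> N" for z M N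
    using that span_mono[of "(\<lambda>m. (F ^^ m) u) ` M" "(\<lambda>m. (F ^^ m) u) ` N"]
    unfolding orbit_def by blast
  have x: "x \<in> orbit {m. 1 \<le> m \<and> 2 * m \<le> 2 ^ k}"
    and y: "y - e \<in> orbit {m. 2 ^ k < 2 * m \<and> m < 2 ^ k}"
    using Suc by (simp_all only: x_def y_def e_def)
  have eH: "e \<in> H"
    unfolding e_def by (rule bounded_operator_powers(1)[OF F u])
  {
    case 1
    let ?M = "{m. 1 \<le> m \<and> 2 * m \<le> 2 ^ Suc k}"
    have "x \<in> orbit ?M" and "y - e \<in> orbit ?M"
      by (rule mono[OF x], force) (rule mono[OF y], force)
    moreover have "e \<in> orbit ?M"
      unfolding orbit_def e_def by (rule span_base) auto
    moreover have "x + scale (of_real (a k)) y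
        = x + (scale (of_real (a k)) (y - e) + scale (of_real (a k)) e)"
      by (simp add: scale_right_diff_distrib)
    ultimately show ?case
      unfolding orbit_def by (simp add: x_def[symmetric] y_def[symmetric] span_add span_scale)
  next
    case 2
    let ?M = "{m. 1 \<le> m \<and> m < 2 ^ k}"
    let ?z = "(y - e) - scale (of_real (a k)) x"
    have "x \<in> orbit ?M" and "y - e \<in> orbit ?M"
      by (rule mono[OF x], force) (rule mono[OF y], force)
    then have z: "?z \<in> orbit ?M"
      unfolding orbit_def by (rule span_diff[OF _ span_scale, rotated])
    note shift = span_orbit_shift[OF F u z[unfolded orbit_def], where s = "2 ^ k"
        and N = "{m. 2 ^ Suc k < 2 * m \<and> m < 2 ^ Suc k}"]
    have "(F ^^ (2 ^ k)) (?z + e) = (F ^^ (2 ^ k)) ?z + (F ^^ (2 ^ k)) e"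
      using shift(1) by (intro bounded_operator_powers(2)[OF F] eH) auto
    moreover have "?z + e = y - scale (of_real (a k)) x"
      by simp
    moreover have "(F ^^ (2 ^ k)) e = (F ^^ (2 ^ Suc k)) u"
      unfolding e_def by (simp add: mult_2 funpow_add)
    ultimately have "snd (lacunary_pair scale F a u (Suc k)) - (F ^^ (2 ^ Suc k)) u
        = (F ^^ (2 ^ k)) ?z"
      by (simp add: x_def[symmetric] y_def[symmetric])
    then show ?case
      using shift(2) unfolding orbit_def by simp
  }
qed

lemma lacunary_pair_in_H:
  assumes F: "bounded_operator scale H ip F" and u: "u \<in> H"
  shows "fst (lacunary_pair scale F a u k) \<in> H" and "snd (lacunary_pair scale F a u k) \<in> H"
proof -
  have "fst (lacunary_pair scale F a u k) \<in> H \<and> snd (lacunary_pair scale F a u k) \<in> H"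
  proof (induction k)
    case 0
    then show ?case
      using F u by (simp add: zero_in_H bounded_operator_def)
  next
    case (Suc k)
    then show ?case
      by (simp add: add_in_H scale_in_H diff_in_H bounded_operator_powers(1)[OF F])
  qed
  then show "fst (lacunary_pair scale F a u k) \<in> H" and "snd (lacunary_pair scale F a u k) \<in> H"
    by auto
qed

lemma functional_lacunary_pair:
  assumes F: "bounded_operator scale H ip F" and u: "u \<in> H"
    and add: "\<And>x y. x \<in> H \<Longrightarrow> y \<in> H \<Longrightarrow> f (x + y) = f x + f y"
    and scale: "\<And>c x. x \<in> H \<Longrightarrow> f (scale c x) = c * f x"
    and zero: "\<And>m. (\<And>k. m \<noteq> 2 ^ k) \<Longrightarrow> f ((F ^^ m) u) = (0::complex)"
  shows "f (fst (lacunary_pair scale F a u K)) = (\<Sum>k<K. of_real (a k) * f ((F ^^ (2 ^ k)) u))"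
proof (induction K)
  case 0
  show ?case
    using scale[OF zero_in_H, of 0] by simp
next
  case (Suc K)
  define y where "y = snd (lacunary_pair scale F a u K)"
  define e where "e = (F ^^ (2 ^ K)) u"
  have yH: "y \<in> H" and eH: "e \<in> H"
    unfolding y_def e_def
    by (rule lacunary_pair_in_H(2)[OF F u], rule bounded_operator_powers(1)[OF F u])
  have "f (y - e) = 0"
  proof (rule functional_vanishes_on_span_orbit[OF F u _ add scale zero])
    show "y - e \<in> span ((\<lambda>m. (F ^^ m) u) ` {m. 2 ^ K < 2 * m \<and> m < 2 ^ K})"
      unfolding y_def e_def by (rule lacunary_pair_spectrum(2)[OF F u])
  next
    fix m k :: nat assume m: "m \<in> {m. 2 ^ K < 2 * m \<and> m < 2 ^ K}"
    show "m \<noteq> 2 ^ k"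
    proof
      assume "m = 2 ^ k"
      then have "(2::nat) ^ K < 2 ^ Suc k" "(2::nat) ^ k < 2 ^ K"
        using m by auto
      then have "K < Suc k" "k < K"
        by (metis power_less_imp_less_exp one_less_numeral_iff semiring_norm(76))+
      then show False
        by simp
    qed
  qed auto
  then have "f y = f e"
    using add[OF diff_in_H[OF yH eH] eH] by simp
  then show ?case
    using Suc lacunary_pair_in_H[OF F u]
    by (simp add: add scale scale_in_H y_def e_def)
qed

text \<open>
  A version of Paley's inequality: if \<open>f (F\<^sup>m u)\<close> vanishes unless \<open>m\<close> is a power of two, then the
  values at the powers of two are square summable, here in dual form. If \<open>S F S\<^sup>-\<^sup>1\<close> is a contraction,
  then \<open>F\<close> does not increase \<open>q x = \<parallel>S x\<parallel>\<^sup>2\<close>. Along the recursion above, the rotation identity multiplies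
  \<open>q x + q y\<close> by \<open>1 + a\<^sub>k\<^sup>2 \<le> exp (a\<^sub>k\<^sup>2)\<close>, and the subsequent application of \<open>F^(2^k)\<close> to the second
  vector can only decrease the sum. So the pair stays bounded as long as the \<open>a\<^sub>k\<^sup>2\<close> have sum at most
  one, and \<open>f\<close> reads off the coefficients of \<open>p\<^sub>K\<close> at the powers of two.
\<close>
lemma lacunary_estimate:
  assumes F: "bounded_operator scale H ip F" and similar: "similar_to_contraction scale H ip F"
    and u: "u \<in> H"
    and add: "\<And>x y. x \<in> H \<Longrightarrow> y \<in> H \<Longrightarrow> f (x + y) = f x + f y"
    and scale: "\<And>c x. x \<in> H \<Longrightarrow> f (scale c x) = c * f x"
    and bound: "\<And>x. x \<in> H \<Longrightarrow> cmod (f x) \<le> hnorm ip x"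
    and zero: "\<And>m. (\<And>k. m \<noteq> 2 ^ k) \<Longrightarrow> f ((F ^^ m) u) = 0"
  obtains C where "\<And>a K. (\<Sum>k<K. (a k)\<^sup>2) \<le> 1 \<Longrightarrow>
    cmod (\<Sum>k<K. of_real (a k) * f ((F ^^ (2 ^ k)) u)) \<le> C"
proof -
  obtain S T where S: "bounded_operator scale H ip S" and T: "bounded_operator scale H ip T"
    and inv: "\<And>x. x \<in> H \<Longrightarrow> T (S x) = x"
    and norm: "operator_norm H ip (S \<circ> F \<circ> T) \<le> 1"
    using similar by (auto simp: similar_to_contraction_def)
  define q where "q x = (hnorm ip (S x))\<^sup>2" for x
  have SH: "S x \<in> H" if "x \<in> H" for x
    using S that by (simp add: bounded_operator_def)
  have contr: "q (F x) \<le> q x" if "x \<in> H" for x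
  proof -
    have "bounded_operator scale H ip (S \<circ> F \<circ> T)"
      using S F T by (intro bounded_operator_comp)
    from hnorm_le_of_operator_norm_le_1[OF this norm SH[OF that]]
    have "hnorm ip (S (F x)) \<le> hnorm ip (S x)"
      using that by (simp add: inv)
    moreover have "F x \<in> H"
      using F that by (simp add: bounded_operator_def)
    ultimately show ?thesis
      unfolding q_def by (intro power_mono hnorm_nonneg SH)
  qed
  have contr_pow: "q ((F ^^ n) x) \<le> q x" if "x \<in> H" for x n
  proof (induction n)
    case (Suc n)
    then show ?case
      using contr[OF bounded_operator_powers(1)[OF F that, of n]] by simp
  qed simp
  have step: "q (x + scale (of_real r) y) + q ((F ^^ n) (y - scale (of_real r) x))
      \<le> exp (r\<^sup>2) * (q x + q y)" if H: "x \<in> H" "y \<in> H" for x y r n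
  proof -
    have "q ((F ^^ n) (y - scale (of_real r) x)) \<le> q (y - scale (of_real r) x)"
      using H by (intro contr_pow diff_in_H scale_in_H)
    moreover have "q (x + scale (of_real r) y) + q (y - scale (of_real r) x)
        = (1 + r\<^sup>2) * (q x + q y)"
      using rotation_identity[OF SH[OF H(1)] SH[OF H(2)], of r] S H
      by (simp add: q_def bounded_operator_def bounded_operator_diff[OF S] scale_in_H)
    moreover have "(1 + r\<^sup>2) * (q x + q y) \<le> exp (r\<^sup>2) * (q x + q y)"
      by (intro mult_right_mono exp_ge_add_one_self) (simp add: q_def)
    ultimately show ?thesis
      by linarith
  qed
  have energy: "q (fst (lacunary_pair scale F a u K)) + q (snd (lacunary_pair scale F a u K))
      \<le> exp (\<Sum>k<K. (a k)\<^sup>2) * q (F u)" for a K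
  proof (induction K)
    case 0
    have "S 0 = 0"
      using S zero_in_H bounded_operator_diff[OF S zero_in_H zero_in_H] by simp
    then show ?case
      by (simp add: q_def hnorm_def ip_zero)
  next
    case (Suc K)
    have "q (fst (lacunary_pair scale F a u (Suc K))) + q (snd (lacunary_pair scale F a u (Suc K)))
        \<le> exp ((a K)\<^sup>2)
            * (q (fst (lacunary_pair scale F a u K)) + q (snd (lacunary_pair scale F a u K)))"
      using step[OF lacunary_pair_in_H[OF F u]] by simp
    also have "\<dots> \<le> exp ((a K)\<^sup>2) * (exp (\<Sum>k<K. (a k)\<^sup>2) * q (F u))"
      by (intro mult_left_mono Suc) simp
    finally show ?case
      by (simp add: exp_add mult_ac)
  qed
  obtain D where D: "0 \<le> D" "\<And>x. x \<in> H \<Longrightarrow> hnorm ip (T x) \<le> D * hnorm ip x"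
    using bounded_operator_bound[OF T] by blast
  show ?thesis
  proof (rule that)
    fix a :: "nat \<Rightarrow> real" and K
    assume a: "(\<Sum>k<K. (a k)\<^sup>2) \<le> 1"
    define x where "x = fst (lacunary_pair scale F a u K)"
    have xH: "x \<in> H"
      unfolding x_def by (rule lacunary_pair_in_H(1)[OF F u])
    have "q x \<le> exp (\<Sum>k<K. (a k)\<^sup>2) * q (F u)"
      using energy[of a K] by (simp add: x_def q_def)
        (smt (verit) zero_le_power2)
    also have "\<dots> \<le> exp 1 * q (F u)"
      using a by (intro mult_right_mono) (auto simp: q_def)
    finally have q: "hnorm ip (S x) \<le> sqrt (exp 1 * q (F u))"
      unfolding q_def by (rule real_le_rsqrt)
    have "cmod (f x) \<le> hnorm ip (T (S x))"
      using bound[OF xH] by (simp add: inv[OF xH])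
    also have "\<dots> \<le> D * hnorm ip (S x)"
      by (rule D(2)[OF SH[OF xH]])
    also have "\<dots> \<le> D * sqrt (exp 1 * q (F u))"
      by (intro mult_left_mono q D(1))
    finally show "cmod (\<Sum>k<K. of_real (a k) * f ((F ^^ (2 ^ k)) u)) \<le> D * sqrt (exp 1 * q (F u))"
      using functional_lacunary_pair[where f = f, OF F u add scale zero] by (simp add: x_def)
  qed
qed

end

section \<open>The Hilbert space of square-summable sequences\<close>

definition l2 :: "(nat \<Rightarrow> complex) set" where
  "l2 = {x. summable (\<lambda>n. (cmod (x n))\<^sup>2)}"

definition l2_ip :: "(nat \<Rightarrow> complex) \<Rightarrow> (nat \<Rightarrow> complex) \<Rightarrow> complex" where
  "l2_ip x y = (\<Sum>n. x n * cnj (y n))"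

definition l2_sq :: "(nat \<Rightarrow> complex) \<Rightarrow> real" where
  "l2_sq x = (\<Sum>n. (cmod (x n))\<^sup>2)"

text \<open>
  With a suitable \<open>t\<close> this replaces the triangle inequality of the sequence space and can be summed
  termwise.
\<close>
lemma cmod_add_sq_le:
  assumes "t > 0"
  shows "(cmod (a + b))\<^sup>2 \<le> (1 + t) * (cmod a)\<^sup>2 + (1 + 1 / t) * (cmod b)\<^sup>2"
proof -
  have "(cmod (a + b))\<^sup>2 \<le> (cmod a + cmod b)\<^sup>2"
    by (intro power_mono norm_triangle_ineq) simp
  also have "\<dots> \<le> (cmod a + cmod b)\<^sup>2 + (t * cmod a - cmod b)\<^sup>2 / t"
    using assms by simp
  also have "\<dots> = (1 + t) * (cmod a)\<^sup>2 + (1 + 1 / t) * (cmod b)\<^sup>2"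
    using assms by (simp add: field_simps power2_eq_square)
  finally show ?thesis .
qed

lemma mult_le_sum_squares:
  fixes a b :: real
  assumes "0 \<le> a" "0 \<le> b"
  shows "a * b \<le> a\<^sup>2 + b\<^sup>2"
  using sum_squares_bound[of a b] mult_nonneg_nonneg[OF assms] by linarith

lemma l2_add: "x \<in> l2 \<Longrightarrow> y \<in> l2 \<Longrightarrow> x + y \<in> l2"
proof -
  assume "x \<in> l2" "y \<in> l2"
  then have "summable (\<lambda>n. 2 * (cmod (x n))\<^sup>2 + 2 * (cmod (y n))\<^sup>2)"
    by (auto simp: l2_def intro: summable_add summable_mult)
  then show "x + y \<in> l2"
    unfolding l2_def mem_Collect_eq
    by (rule summable_comparison_test') (use cmod_add_sq_le[of 1] in auto)
qed

lemma l2_scale: "x \<in> l2 \<Longrightarrow> (\<lambda>n. c * x n) \<in> l2"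
  by (simp add: l2_def norm_mult power_mult_distrib summable_mult)

lemma summable_l2_ip:
  assumes "x \<in> l2" "y \<in> l2"
  shows "summable (\<lambda>n. x n * cnj (y n))"
proof (rule summable_comparison_test')
  show "summable (\<lambda>n. (cmod (x n))\<^sup>2 + (cmod (y n))\<^sup>2)"
    using assms by (auto simp: l2_def intro: summable_add)
  show "norm (x n * cnj (y n)) \<le> (cmod (x n))\<^sup>2 + (cmod (y n))\<^sup>2" for n
    using mult_le_sum_squares[of "cmod (x n)" "cmod (y n)"] by (simp add: norm_mult)
qed

lemma Re_l2_ip:
  assumes "x \<in> l2"
  shows "Re (l2_ip x x) = l2_sq x"
proof -
  have "(\<lambda>n. complex_of_real ((cmod (x n))\<^sup>2)) sums of_real (l2_sq x)"
    using assms unfolding l2_sq_def l2_def by (intro sums_of_real summable_sums) simp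
  then have "l2_ip x x = of_real (l2_sq x)"
    unfolding l2_ip_def complex_norm_square by (rule sums_unique[symmetric])
  then show ?thesis
    by simp
qed

lemma hnorm_l2: "x \<in> l2 \<Longrightarrow> hnorm l2_ip x = sqrt (l2_sq x)"
  by (simp add: hnorm_def Re_l2_ip)

lemma l2_sq_nonneg: "x \<in> l2 \<Longrightarrow> 0 \<le> l2_sq x"
  by (simp add: l2_def l2_sq_def suminf_nonneg)

lemma sum_le_l2_sq: "x \<in> l2 \<Longrightarrow> finite A \<Longrightarrow> (\<Sum>n\<in>A. (cmod (x n))\<^sup>2) \<le> l2_sq x"
  by (simp add: l2_def l2_sq_def sum_le_suminf)

text \<open>
  All norm estimates on sequences are obtained through finite partial sums.
\<close>
lemma l2_boundedI:
  assumes "\<And>N. (\<Sum>n<N. (cmod (x n))\<^sup>2) \<le> B"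
  shows "x \<in> l2" and "l2_sq x \<le> B"
proof -
  show x: "x \<in> l2"
    unfolding l2_def mem_Collect_eq
    by (rule bounded_imp_summable[where B = B]) (use assms[of "Suc _"] in \<open>auto simp: lessThan_Suc_atMost\<close>)
  then show "l2_sq x \<le> B"
    unfolding l2_sq_def l2_def using assms by (intro suminf_le_const) auto
qed

lemma cmod_le_l2: "x \<in> l2 \<Longrightarrow> cmod (x n) \<le> hnorm l2_ip x"
  using sum_le_l2_sq[of x "{n}"] by (simp add: hnorm_l2 real_le_rsqrt)

text \<open>
  A Cauchy sequence converges in each coordinate; passing to the limit in finite partial sums of the
  norms shows that the pointwise limit is also the limit in norm.
\<close>
lemma l2_complete:
  assumes X: "\<And>n. X n \<in> l2" and diff: "\<And>m n. X m - X n \<in> l2"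
    and Cauchy: "\<forall>e>0. \<exists>N. \<forall>m\<ge>N. \<forall>n\<ge>N. hnorm l2_ip (X m - X n) < e"
  shows "\<exists>l\<in>l2. (\<lambda>n::nat. hnorm l2_ip (X n - l)) \<longlonglongrightarrow> 0"
proof -
  have "\<exists>l. (\<lambda>m. X m i) \<longlonglongrightarrow> l" for i
  proof -
    have "Cauchy (\<lambda>m. X m i)"
    proof (rule CauchyI)
      fix e :: real assume "e > 0"
      then obtain N where N: "\<forall>m\<ge>N. \<forall>n\<ge>N. hnorm l2_ip (X m - X n) < e"
        using Cauchy by blast
      have "norm (X m i - X n i) < e" if "m \<ge> N" "n \<ge> N" for m n
        using N that cmod_le_l2[OF diff[of m n], of i] by fastforce
      then show "\<exists>N. \<forall>m\<ge>N. \<forall>n\<ge>N. norm (X m i - X n i) < e"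
        by blast
    qed
    then show ?thesis
      by (simp add: Cauchy_convergent_iff convergent_def)
  qed
  then obtain l where l: "\<And>i. (\<lambda>m. X m i) \<longlonglongrightarrow> l i"
    by metis
  have tail: "\<exists>N. \<forall>m\<ge>N. X m - l \<in> l2 \<and> l2_sq (X m - l) \<le> e\<^sup>2" if "e > 0" for e
  proof -
    obtain N where N: "\<And>m n. m \<ge> N \<Longrightarrow> n \<ge> N \<Longrightarrow> hnorm l2_ip (X m - X n) < e"
      using Cauchy \<open>e > 0\<close> by blast
    have "(\<Sum>i<I. (cmod ((X m - l) i))\<^sup>2) \<le> e\<^sup>2" if m: "m \<ge> N" for m I
    proof (rule LIMSEQ_le_const2)
      show "(\<lambda>n. \<Sum>i<I. (cmod ((X m - X n) i))\<^sup>2) \<longlonglongrightarrow> (\<Sum>i<I. (cmod ((X m - l) i))\<^sup>2)"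
        by (auto intro!: tendsto_intros l)
      have "(\<Sum>i<I. (cmod ((X m - X n) i))\<^sup>2) \<le> e\<^sup>2" if n: "n \<ge> N" for n
      proof -
        have "(\<Sum>i<I. (cmod ((X m - X n) i))\<^sup>2) \<le> l2_sq (X m - X n)"
          by (intro sum_le_l2_sq diff) simp
        also have "\<dots> = (hnorm l2_ip (X m - X n))\<^sup>2"
          by (simp add: hnorm_l2[OF diff] l2_sq_nonneg[OF diff])
        also have "\<dots> \<le> e\<^sup>2"
          using N[OF m n] by (intro power_mono) (auto simp: hnorm_l2[OF diff] l2_sq_nonneg[OF diff])
        finally show ?thesis .
      qed
      then show "\<exists>N. \<forall>n\<ge>N. (\<Sum>i<I. (cmod ((X m - X n) i))\<^sup>2) \<le> e\<^sup>2"
        by blast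
    qed
    then show ?thesis
      using l2_boundedI[of "X _ - l" "e\<^sup>2"] by blast
  qed
  have l2: "l \<in> l2"
  proof -
    obtain m where "X m - l \<in> l2"
      using tail[of 1] by auto
    then have "X m + (\<lambda>n. (-1) * (X m - l) n) \<in> l2"
      by (intro l2_add X l2_scale)
    also have "X m + (\<lambda>n. (-1) * (X m - l) n) = l"
      by (rule ext) simp
    finally show ?thesis .
  qed
  have "(\<lambda>n. hnorm l2_ip (X n - l)) \<longlonglongrightarrow> 0"
  proof (rule LIMSEQ_I)
    fix e :: real assume "e > 0"
    then obtain N where N: "\<And>m. m \<ge> N \<Longrightarrow> X m - l \<in> l2 \<and> l2_sq (X m - l) \<le> (e / 2)\<^sup>2"
      using tail[of "e / 2"] by auto
    have "norm (hnorm l2_ip (X m - l) - 0) < e" if "m \<ge> N" for m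
    proof -
      have "sqrt (l2_sq (X m - l)) \<le> e / 2"
        using N[OF that] \<open>e > 0\<close> by (intro real_le_lsqrt) auto
      then show ?thesis
        using N[OF that] \<open>e > 0\<close> by (simp add: hnorm_l2 l2_sq_nonneg)
    qed
    then show "\<exists>N. \<forall>m\<ge>N. norm (hnorm l2_ip (X m - l) - 0) < e"
      by blast
  qed
  with l2 show ?thesis
    by blast
qed

definition pointwise_scale :: "complex \<Rightarrow> (nat \<Rightarrow> complex) \<Rightarrow> nat \<Rightarrow> complex" where
  "pointwise_scale c x = (\<lambda>n. c * x n)"

interpretation l2: complex_hilbert_space pointwise_scale l2 l2_ip
proof -
  interpret vector_space pointwise_scale
    by standard (auto simp: pointwise_scale_def fun_eq_iff algebra_simps)
  have sub: "subspace l2"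
  proof (rule subspaceI)
    show "0 \<in> l2"
      by (simp add: l2_def)
  qed (auto simp: pointwise_scale_def intro: l2_add l2_scale)
  show "complex_hilbert_space pointwise_scale l2 l2_ip"
  proof (unfold_locales)
    show "subspace l2"
      by (rule sub)
    show "l2_ip (x + y) z = l2_ip x z + l2_ip y z" if "x \<in> l2" "y \<in> l2" "z \<in> l2" for x y z
      using suminf_add[OF summable_l2_ip[OF that(1,3)] summable_l2_ip[OF that(2,3)]]
      by (simp add: l2_ip_def algebra_simps)
    show "l2_ip (pointwise_scale c x) y = c * l2_ip x y" if "x \<in> l2" "y \<in> l2" for x y c
      using suminf_mult[OF summable_l2_ip[OF that], of c]
      by (simp add: l2_ip_def pointwise_scale_def mult_ac)
    show "l2_ip y x = cnj (l2_ip x y)" if "x \<in> l2" "y \<in> l2" for x y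
    proof -
      have "(\<lambda>n. cnj (x n * cnj (y n))) sums cnj (l2_ip x y)"
        unfolding l2_ip_def sums_cnj by (rule summable_sums[OF summable_l2_ip[OF that]])
      then show ?thesis
        using sums_unique by (force simp: l2_ip_def mult_ac)
    qed
    show "0 < Re (l2_ip x x)" if "x \<in> l2" "x \<noteq> 0" for x
    proof -
      obtain i where "x i \<noteq> 0"
        using \<open>x \<noteq> 0\<close> by (auto simp: fun_eq_iff)
      then have "0 < (\<Sum>n. (cmod (x n))\<^sup>2)"
        using \<open>x \<in> l2\<close> by (intro suminf_pos2[of _ i]) (auto simp: l2_def)
      then show ?thesis
        by (simp add: Re_l2_ip[OF \<open>x \<in> l2\<close>] l2_sq_def)
    qed
    show "\<exists>l\<in>l2. (\<lambda>n::nat. hnorm l2_ip (X n - l)) \<longlonglongrightarrow> 0"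
      if "\<forall>n. X n \<in> l2" "\<forall>e>0. \<exists>N. \<forall>m\<ge>N. \<forall>n\<ge>N. hnorm l2_ip (X m - X n) < e" for X
      using that by (intro l2_complete subspace_diff[OF sub]) auto
  qed
qed

section \<open>Foguel operators with a lacunary Hankel corner\<close>

text \<open>
  The Hankel matrix \<open>\<Gamma>\<close> with symbol \<open>\<Sum>\<^sub>k c\<^sub>k z^(2^k - 1)\<close> has the entry \<open>c\<^sub>k\<close> at \<open>(i, j)\<close> if
  \<open>i + j + 1 = 2^k\<close> and zero entries elsewhere. With the backward shift \<open>B\<close>, row \<open>i\<close> of \<open>B^(n-1) \<Gamma>\<close>
  depends on \<open>n + i\<close> only; \<open>lacunary_hankel c (n + i) w\<close> is entry \<open>i\<close> of \<open>B^(n-1) \<Gamma> w\<close>.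
\<close>
definition lacunary_hankel :: "(nat \<Rightarrow> real) \<Rightarrow> nat \<Rightarrow> (nat \<Rightarrow> complex) \<Rightarrow> complex" where
  "lacunary_hankel c s w = (\<Sum>k. if s \<le> 2 ^ k then of_real (c k) * w (2 ^ k - s) else 0)"

lemma inj_on_power_of_two_minus: "inj_on (\<lambda>k. 2 ^ k - s) {k. s \<le> (2::nat) ^ k}"
proof (rule inj_onI)
  fix j k :: nat
  assume "j \<in> {k. s \<le> 2 ^ k}" "k \<in> {k. s \<le> 2 ^ k}" "(2::nat) ^ j - s = 2 ^ k - s"
  then have "(2::nat) ^ j = 2 ^ k"
    using eq_diff_iff[of s "2 ^ j" "2 ^ k"] by simp
  then show "j = k"
    by simp
qed

lemma summable_lacunary_hankel:
  assumes w: "w \<in> l2" and c: "summable (\<lambda>k. (c k)\<^sup>2)"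
  shows "summable (\<lambda>k. if s \<le> 2 ^ k then complex_of_real (c k) * w (2 ^ k - s) else 0)"
proof (rule summable_comparison_test')
  let ?g = "\<lambda>k. if s \<le> 2 ^ k then (cmod (w (2 ^ k - s)))\<^sup>2 else 0"
  have "summable ?g"
  proof (rule bounded_imp_summable)
    fix K
    let ?A = "{k. k \<le> K \<and> s \<le> 2 ^ k}"
    have "sum ?g {..K} = (\<Sum>k\<in>?A. (cmod (w (2 ^ k - s)))\<^sup>2)"
      by (rule sum.mono_neutral_cong_right) auto
    also have "\<dots> = (\<Sum>j\<in>(\<lambda>k. 2 ^ k - s) ` ?A. (cmod (w j))\<^sup>2)"
      by (subst sum.reindex) (auto intro: inj_on_subset[OF inj_on_power_of_two_minus])
    also have "\<dots> \<le> l2_sq w"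
      by (rule sum_le_l2_sq[OF w]) simp
    finally show "sum ?g {..K} \<le> l2_sq w" .
  qed simp
  with c show "summable (\<lambda>k. (c k)\<^sup>2 + ?g k)"
    by (rule summable_add)
  show "norm (if s \<le> 2 ^ k then complex_of_real (c k) * w (2 ^ k - s) else 0) \<le> (c k)\<^sup>2 + ?g k" for k
    using mult_le_sum_squares[of "\<bar>c k\<bar>" "cmod (w (2 ^ k - s))"] by (auto simp: norm_mult)
qed

lemma lacunary_hankel_add:
  assumes c: "summable (\<lambda>k. (c k)\<^sup>2)" and "v \<in> l2" "w \<in> l2"
  shows "lacunary_hankel c s (\<lambda>j. v j + w j) = lacunary_hankel c s v + lacunary_hankel c s w"
  unfolding lacunary_hankel_def
    suminf_add[OF summable_lacunary_hankel[OF assms(2) c] summable_lacunary_hankel[OF assms(3) c]]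
  by (rule suminf_cong) (simp add: algebra_simps)

lemma lacunary_hankel_scale:
  assumes c: "summable (\<lambda>k. (c k)\<^sup>2)" and "w \<in> l2"
  shows "lacunary_hankel c s (\<lambda>j. r * w j) = r * lacunary_hankel c s w"
  unfolding lacunary_hankel_def suminf_mult[OF summable_lacunary_hankel[OF assms(2) c], symmetric]
  by (rule suminf_cong) simp

lemma cmod_sum_mult_sq_le:
  "(cmod (\<Sum>k\<in>A. of_real (c k) * z k))\<^sup>2 \<le> (\<Sum>k\<in>A. (c k)\<^sup>2) * (\<Sum>k\<in>A. (cmod (z k))\<^sup>2)"
proof -
  have "cmod (\<Sum>k\<in>A. of_real (c k) * z k) \<le> (\<Sum>k\<in>A. \<bar>c k\<bar> * cmod (z k))"
    by (rule order_trans[OF norm_sum]) (simp add: norm_mult)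
  then have "(cmod (\<Sum>k\<in>A. of_real (c k) * z k))\<^sup>2 \<le> (\<Sum>k\<in>A. \<bar>c k\<bar> * cmod (z k))\<^sup>2"
    by (intro power_mono) simp_all
  also have "\<dots> \<le> (\<Sum>k\<in>A. \<bar>c k\<bar>\<^sup>2) * (\<Sum>k\<in>A. (cmod (z k))\<^sup>2)"
    by (rule Cauchy_Schwarz_ineq_sum)
  finally show ?thesis
    by simp
qed

lemma power_of_two_gap: "j < k \<Longrightarrow> 2 * 2 ^ j \<le> (2::nat) ^ k"
  using power_increasing[of "Suc j" k "2::nat"] by simp

text \<open>
  The part of the Hankel matrix on and above the diagonal, that is \<open>i \<le> j\<close> where \<open>j = 2^k - (n + i)\<close>.
  For given \<open>j\<close> the power \<open>2^k = n + i + j\<close> lies in \<open>[n + j, n + 2 j]\<close>, which contains at most one power of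
  two as \<open>n \<ge> 1\<close>. So each column has at most one nonzero entry: distinct rows have disjoint supports,
  and the norm is the largest norm of a row.
\<close>
lemma lacunary_hankel_upper_bound:
  assumes w: "w \<in> l2" and n: "n \<ge> 1"
    and C: "(\<Sum>k\<in>{k. k < K \<and> n \<le> 2 ^ k}. (c k)\<^sup>2) \<le> C"
  shows "(\<Sum>i<I. (cmod (\<Sum>k\<in>{k. k < K \<and> n + 2 * i \<le> 2 ^ k}.
            of_real (c k) * w (2 ^ k - (n + i))))\<^sup>2) \<le> C * l2_sq w"
proof -
  define A where "A i = {k. k < K \<and> n + 2 * i \<le> 2 ^ k}" for i
  have [simp]: "finite (A i)" for i
    by (simp add: A_def)
  have C0: "0 \<le> C"
    using C by (rule order_trans[rotated]) (simp add: sum_nonneg)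
  have row: "(cmod (\<Sum>k\<in>A i. of_real (c k) * w (2 ^ k - (n + i))))\<^sup>2
      \<le> C * (\<Sum>k\<in>A i. (cmod (w (2 ^ k - (n + i))))\<^sup>2)" for i
  proof -
    have "(\<Sum>k\<in>A i. (c k)\<^sup>2) \<le> (\<Sum>k\<in>{k. k < K \<and> n \<le> 2 ^ k}. (c k)\<^sup>2)"
      by (rule sum_mono2) (auto simp: A_def)
    then show ?thesis
      using C by (intro order_trans[OF cmod_sum_mult_sq_le] mult_right_mono) (auto intro: sum_nonneg)
  qed
  have inj: "inj_on (\<lambda>(i, k). 2 ^ k - (n + i)) (SIGMA i:{..<I}. A i)"
  proof (rule inj_onI, clarify)
    fix i k i' k'
    assume k: "k \<in> A i" and k': "k' \<in> A i'" and eq: "(2::nat) ^ k - (n + i) = 2 ^ k' - (n + i')"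
    have "\<not> k < k'" "\<not> k' < k"
      using k k' eq n power_of_two_gap[of k k'] power_of_two_gap[of k' k] by (auto simp: A_def)
    then have "k = k'"
      by simp
    then show "i = i' \<and> k = k'"
      using k k' eq by (auto simp: A_def)
  qed
  have "(\<Sum>i<I. (cmod (\<Sum>k\<in>A i. of_real (c k) * w (2 ^ k - (n + i))))\<^sup>2)
      \<le> (\<Sum>i<I. C * (\<Sum>k\<in>A i. (cmod (w (2 ^ k - (n + i))))\<^sup>2))"
    by (intro sum_mono row)
  also have "\<dots> = C * (\<Sum>(i, k)\<in>(SIGMA i:{..<I}. A i). (cmod (w (2 ^ k - (n + i))))\<^sup>2)"
    by (simp add: sum_distrib_left[symmetric] sum.Sigma)
  also have "(\<Sum>(i, k)\<in>(SIGMA i:{..<I}. A i). (cmod (w (2 ^ k - (n + i))))\<^sup>2)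
      = (\<Sum>j\<in>(\<lambda>(i, k). 2 ^ k - (n + i)) ` (SIGMA i:{..<I}. A i). (cmod (w j))\<^sup>2)"
    by (subst sum.reindex[OF inj]) (simp add: case_prod_unfold)
  also have "C * \<dots> \<le> C * l2_sq w"
    by (intro mult_left_mono sum_le_l2_sq w C0) auto
  finally show ?thesis
    by (simp add: A_def)
qed

text \<open>
  The part of the Hankel matrix strictly below the diagonal, where by symmetry each row has at most one
  nonzero entry, and every column has norm at most \<open>sqrt C\<close>.
\<close>
lemma lacunary_hankel_lower_bound:
  assumes w: "w \<in> l2" and n: "n \<ge> 1"
    and C: "(\<Sum>k\<in>{k. k < K \<and> n \<le> 2 ^ k}. (c k)\<^sup>2) \<le> C"
  shows "(\<Sum>i<I. (cmod (\<Sum>k\<in>{k. k < K \<and> n + i \<le> 2 ^ k \<and> 2 ^ k < n + 2 * i}.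
            of_real (c k) * w (2 ^ k - (n + i))))\<^sup>2) \<le> C * l2_sq w"
proof -
  define A where "A i = {k. k < K \<and> n + i \<le> 2 ^ k \<and> 2 ^ k < n + 2 * i}" for i
  define R where "R = {k. k < K \<and> n \<le> 2 ^ k}"
  let ?P = "SIGMA i:{..<I}. A i"
  let ?h = "\<lambda>(i, k). (2 ^ k - (n + i), k)"
  have [simp]: "finite (A i)" for i
    by (simp add: A_def)
  have row: "(cmod (\<Sum>k\<in>A i. of_real (c k) * w (2 ^ k - (n + i))))\<^sup>2
      = (\<Sum>k\<in>A i. (c k)\<^sup>2 * (cmod (w (2 ^ k - (n + i))))\<^sup>2)" for i
  proof (cases "A i = {}")
    case False
    then obtain k where k: "k \<in> A i"
      by blast
    have "k' = k" if k': "k' \<in> A i" for k'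
    proof -
      have "\<not> k < k'" "\<not> k' < k"
        using k k' n power_of_two_gap[of k k'] power_of_two_gap[of k' k] by (auto simp: A_def)
      then show ?thesis
        by simp
    qed
    with k have "A i = {k}"
      by blast
    then show ?thesis
      by (simp add: norm_mult power_mult_distrib)
  qed simp
  have inj: "inj_on ?h ?P"
    by (rule inj_onI) (auto simp: A_def)
  define J where "J = fst ` ?h ` ?P"
  have "(\<Sum>i<I. (cmod (\<Sum>k\<in>A i. of_real (c k) * w (2 ^ k - (n + i))))\<^sup>2)
      = (\<Sum>(i, k)\<in>?P. (c k)\<^sup>2 * (cmod (w (2 ^ k - (n + i))))\<^sup>2)"
    unfolding row by (subst sum.Sigma) auto
  also have "\<dots> = (\<Sum>(j, k)\<in>?h ` ?P. (c k)\<^sup>2 * (cmod (w j))\<^sup>2)"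
    by (subst sum.reindex[OF inj]) (simp add: case_prod_unfold)
  also have "\<dots> \<le> (\<Sum>(j, k)\<in>J \<times> R. (c k)\<^sup>2 * (cmod (w j))\<^sup>2)"
  proof (rule sum_mono2)
    show "?h ` ?P \<subseteq> J \<times> R"
      unfolding J_def R_def A_def by force
  qed (auto simp: J_def R_def)
  also have "\<dots> = (\<Sum>k\<in>R. (c k)\<^sup>2) * (\<Sum>j\<in>J. (cmod (w j))\<^sup>2)"
    unfolding sum_product sum.cartesian_product[symmetric] by (rule sum.swap)
  also have "\<dots> \<le> C * l2_sq w"
    using C w by (intro mult_mono sum_le_l2_sq) (auto simp: R_def J_def l2_sq_nonneg intro: sum_nonneg
        order_trans[OF sum_nonneg C])
  finally show ?thesis
    by (simp add: A_def)
qed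

lemma lacunary_hankel_bound:
  assumes w: "w \<in> l2" and n: "n \<ge> 1" and c: "summable (\<lambda>k. (c k)\<^sup>2)"
    and C: "\<And>K. (\<Sum>k\<in>{k. k < K \<and> n \<le> 2 ^ k}. (c k)\<^sup>2) \<le> C"
  shows "(\<Sum>i<I. (cmod (lacunary_hankel c (n + i) w))\<^sup>2) \<le> 4 * C * l2_sq w"
proof (rule LIMSEQ_le_const2)
  let ?t = "\<lambda>i k. complex_of_real (c k) * w (2 ^ k - (n + i))"
  show "(\<lambda>K. \<Sum>i<I. (cmod (\<Sum>k<K. if n + i \<le> 2 ^ k then ?t i k else 0))\<^sup>2)
      \<longlonglongrightarrow> (\<Sum>i<I. (cmod (lacunary_hankel c (n + i) w))\<^sup>2)"
    unfolding lacunary_hankel_def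
    by (intro tendsto_intros summable_LIMSEQ summable_lacunary_hankel w c)
  have "(\<Sum>i<I. (cmod (\<Sum>k<K. if n + i \<le> 2 ^ k then ?t i k else 0))\<^sup>2) \<le> 4 * C * l2_sq w" for K
  proof -
    define up where "up i = (\<Sum>k\<in>{k. k < K \<and> n + 2 * i \<le> 2 ^ k}. ?t i k)" for i
    define low where "low i = (\<Sum>k\<in>{k. k < K \<and> n + i \<le> 2 ^ k \<and> 2 ^ k < n + 2 * i}. ?t i k)" for i
    have split: "(\<Sum>k<K. if n + i \<le> 2 ^ k then ?t i k else 0) = up i + low i" for i
    proof -
      have "(\<Sum>k<K. if n + i \<le> 2 ^ k then ?t i k else 0) = (\<Sum>k\<in>{k. k < K \<and> n + i \<le> 2 ^ k}. ?t i k)"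
        by (rule sum.mono_neutral_cong_right) auto
      also have "{k. k < K \<and> n + i \<le> 2 ^ k} = {k. k < K \<and> n + 2 * i \<le> 2 ^ k}
          \<union> {k. k < K \<and> n + i \<le> 2 ^ k \<and> 2 ^ k < n + 2 * i}"
        by auto
      finally show ?thesis
        unfolding up_def low_def by (subst (asm) sum.union_disjoint) auto
    qed
    have "(\<Sum>i<I. (cmod (up i + low i))\<^sup>2) \<le> (\<Sum>i<I. 2 * (cmod (up i))\<^sup>2 + 2 * (cmod (low i))\<^sup>2)"
      using cmod_add_sq_le[of 1] by (intro sum_mono) auto
    also have "\<dots> = 2 * (\<Sum>i<I. (cmod (up i))\<^sup>2) + 2 * (\<Sum>i<I. (cmod (low i))\<^sup>2)"
      by (simp add: sum.distrib sum_distrib_left)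
    also have "\<dots> \<le> 2 * (C * l2_sq w) + 2 * (C * l2_sq w)"
      unfolding up_def low_def
      using lacunary_hankel_upper_bound[where I = I, OF w n C] lacunary_hankel_lower_bound[where I = I, OF w n C]
      by (intro add_mono mult_left_mono) auto
    finally show ?thesis
      by (simp add: split)
  qed
  then show "\<exists>N. \<forall>K\<ge>N. (\<Sum>i<I. (cmod (\<Sum>k<K. if n + i \<le> 2 ^ k then ?t i k else 0))\<^sup>2)
      \<le> 4 * C * l2_sq w"
    by blast
qed

text \<open>
  A sequence \<open>x\<close> stands for the pair of \<open>u\<^sub>i = x (2 i)\<close> and \<open>w\<^sub>i = x (2 i + 1)\<close>. On such pairs, with the
  shift \<open>A\<close> and the backward shift \<open>B\<close>, the Foguel operator is \<open>(u, w) \<mapsto> (B u + \<Gamma> w, A w)\<close>.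
  As \<open>\<Gamma> A = B \<Gamma>\<close>, its \<open>n\<close>-th power has the closed form \<open>(u, w) \<mapsto> (B\<^sup>n u + n B^(n-1) \<Gamma> w, A\<^sup>n w)\<close> used
  here as the definition; the operator itself is the case \<open>n = 1\<close>.
\<close>
definition foguel_power :: "(nat \<Rightarrow> real) \<Rightarrow> nat \<Rightarrow> (nat \<Rightarrow> complex) \<Rightarrow> nat \<Rightarrow> complex" where
  "foguel_power c n x = (\<lambda>m.
     if even m then x (m + 2 * n) + of_nat n * lacunary_hankel c (n + m div 2) (\<lambda>j. x (2 * j + 1))
     else if 2 * n \<le> m then x (m - 2 * n) else 0)"

lemma foguel_power_Suc:
  "foguel_power c 1 (foguel_power c n x) = foguel_power c (Suc n) x"
proof (rule ext)
  fix m
  show "foguel_power c 1 (foguel_power c n x) m = foguel_power c (Suc n) x m"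
  proof (cases "even m")
    case True
    have hankel: "lacunary_hankel c (1 + m div 2) (\<lambda>j. foguel_power c n x (2 * j + 1))
        = lacunary_hankel c (Suc n + m div 2) (\<lambda>j. x (2 * j + 1))"
      unfolding lacunary_hankel_def
    proof (rule suminf_cong)
      fix k
      have "2 * (2 ^ k - (1 + m div 2)) + 1 - 2 * n = 2 * (2 ^ k - (Suc n + m div 2)) + 1"
        if "Suc n + m div 2 \<le> 2 ^ k"
        using that by linarith
      then show "(if 1 + m div 2 \<le> 2 ^ k
             then of_real (c k) * foguel_power c n x (2 * (2 ^ k - (1 + m div 2)) + 1) else 0)
          = (if Suc n + m div 2 \<le> 2 ^ k
             then of_real (c k) * x (2 * (2 ^ k - (Suc n + m div 2)) + 1) else 0)"
        by (auto simp: foguel_power_def)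
    qed
    have "foguel_power c 1 (foguel_power c n x) m = foguel_power c n x (m + 2)
        + lacunary_hankel c (1 + m div 2) (\<lambda>j. foguel_power c n x (2 * j + 1))"
      using True unfolding foguel_power_def[of c 1] by simp
    moreover have "foguel_power c n x (m + 2) = x (m + 2 * Suc n)
        + of_nat n * lacunary_hankel c (Suc n + m div 2) (\<lambda>j. x (2 * j + 1))"
      using True by (simp add: foguel_power_def)
    moreover have "foguel_power c (Suc n) x m = x (m + 2 * Suc n)
        + of_nat (Suc n) * lacunary_hankel c (Suc n + m div 2) (\<lambda>j. x (2 * j + 1))"
      using True by (simp only: foguel_power_def if_True)
    ultimately show ?thesis
      by (simp only: hankel of_nat_Suc distrib_right mult_1_left) (simp only: add_ac)
  next
    case False
    then show ?thesis
      by (auto simp: foguel_power_def)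
  qed
qed

lemma funpow_foguel: "(foguel_power c 1 ^^ n) x = foguel_power c n x"
proof (induction n)
  case 0
  show ?case
    by (auto simp: foguel_power_def)
next
  case (Suc n)
  then show ?case
    using foguel_power_Suc[of c n x] by simp
qed

lemma sum_even_odd: "(\<Sum>m<2 * N. f m) = (\<Sum>i<N. f (2 * i)) + (\<Sum>i<N. f (2 * i + 1 :: nat))"
  for f :: "nat \<Rightarrow> real"
  by (induction N) (auto simp: algebra_simps)

lemma l2_even_odd:
  assumes "x \<in> l2"
  shows "(\<lambda>j. x (2 * j)) \<in> l2" and "(\<lambda>j. x (2 * j + 1)) \<in> l2"
    and "l2_sq (\<lambda>j. x (2 * j)) + l2_sq (\<lambda>j. x (2 * j + 1)) = l2_sq x"
proof -
  have le: "(\<Sum>i<N. (cmod (x (2 * i)))\<^sup>2) + (\<Sum>i<N. (cmod (x (2 * i + 1)))\<^sup>2) \<le> l2_sq x" for N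
    using sum_le_l2_sq[OF assms, of "{..<2 * N}"] by (simp add: sum_even_odd)
  have nonneg: "0 \<le> (\<Sum>i<N. (cmod (x (2 * i)))\<^sup>2)" "0 \<le> (\<Sum>i<N. (cmod (x (2 * i + 1)))\<^sup>2)" for N
    by (simp_all add: sum_nonneg)
  show e: "(\<lambda>j. x (2 * j)) \<in> l2"
  proof (rule l2_boundedI(1))
    show "(\<Sum>i<N. (cmod (x (2 * i)))\<^sup>2) \<le> l2_sq x" for N
      using le[of N] nonneg(2)[of N] by linarith
  qed
  show o: "(\<lambda>j. x (2 * j + 1)) \<in> l2"
  proof (rule l2_boundedI(1))
    show "(\<Sum>i<N. (cmod (x (2 * i + 1)))\<^sup>2) \<le> l2_sq x" for N
      using le[of N] nonneg(1)[of N] by linarith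
  qed
  have "(\<lambda>N. \<Sum>m<2 * N. (cmod (x m))\<^sup>2) \<longlonglongrightarrow> l2_sq x"
    using LIMSEQ_subseq_LIMSEQ[of "\<lambda>N. \<Sum>m<N. (cmod (x m))\<^sup>2" "l2_sq x" "(*) 2"] assms
    by (simp add: l2_sq_def l2_def summable_LIMSEQ o_def strict_mono_def)
  moreover have "(\<lambda>N. \<Sum>m<2 * N. (cmod (x m))\<^sup>2)
      \<longlonglongrightarrow> l2_sq (\<lambda>j. x (2 * j)) + l2_sq (\<lambda>j. x (2 * j + 1))"
    unfolding sum_even_odd using e o unfolding l2_sq_def l2_def
    by (intro tendsto_add summable_LIMSEQ) auto
  ultimately show "l2_sq (\<lambda>j. x (2 * j)) + l2_sq (\<lambda>j. x (2 * j + 1)) = l2_sq x"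
    by (rule LIMSEQ_unique[rotated])
qed

text \<open>
  The shifts do not increase norms and the corner of the \<open>n\<close>-th power has norm at most \<open>2 n sqrt C \<le> t\<close>,
  which gives \<open>1 + t\<close> in total. The weight \<open>t\<close> in the inequality for \<open>|a + b|\<^sup>2\<close> is the one that turns
  these two bounds into exactly \<open>(1 + t)\<^sup>2\<close>.
\<close>
lemma foguel_power_bound:
  assumes x: "x \<in> l2" and n: "n \<ge> 1" and c: "summable (\<lambda>k. (c k)\<^sup>2)" and t: "t > 0"
    and C: "\<And>K. (\<Sum>k\<in>{k. k < K \<and> n \<le> 2 ^ k}. (c k)\<^sup>2) \<le> C" and Ct: "(2 * real n)\<^sup>2 * C \<le> t\<^sup>2"
  shows "foguel_power c n x \<in> l2" and "hnorm l2_ip (foguel_power c n x) \<le> (1 + t) * hnorm l2_ip x"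
proof -
  define u where "u = (\<lambda>j. x (2 * j))"
  define w where "w = (\<lambda>j. x (2 * j + 1))"
  define y where "y = foguel_power c n x"
  have u: "u \<in> l2" and w: "w \<in> l2" and split: "l2_sq u + l2_sq w = l2_sq x"
    unfolding u_def w_def by (rule l2_even_odd[OF x])+
  note nonneg = l2_sq_nonneg[OF u] l2_sq_nonneg[OF w]
  have y_even: "y (2 * i) = u (i + n) + of_nat n * lacunary_hankel c (n + i) w" for i
    by (simp add: y_def foguel_power_def u_def w_def algebra_simps)
  have y_odd: "y (2 * i + 1) = (if n \<le> i then w (i - n) else 0)" for i
  proof (cases "n \<le> i")
    case True
    then have "2 * i + 1 - 2 * n = 2 * (i - n) + 1"
      by linarith
    then show ?thesis
      using True by (simp add: y_def foguel_power_def w_def)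
  qed (simp add: y_def foguel_power_def)
  have even: "(\<Sum>i<N. (cmod (y (2 * i)))\<^sup>2) \<le> (1 + t) * l2_sq u + (t + t\<^sup>2) * l2_sq w" for N
  proof -
    have "(\<Sum>i<N. (cmod (y (2 * i)))\<^sup>2)
        \<le> (\<Sum>i<N. (1 + t) * (cmod (u (i + n)))\<^sup>2
             + (1 + 1 / t) * ((real n)\<^sup>2 * (cmod (lacunary_hankel c (n + i) w))\<^sup>2))"
      unfolding y_even using cmod_add_sq_le[OF t, of _ "of_nat n * _"]
      by (intro sum_mono) (simp add: norm_mult power_mult_distrib)
    also have "\<dots> = (1 + t) * (\<Sum>i<N. (cmod (u (i + n)))\<^sup>2)
        + (1 + 1 / t) * ((real n)\<^sup>2 * (\<Sum>i<N. (cmod (lacunary_hankel c (n + i) w))\<^sup>2))"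
      by (simp add: sum.distrib sum_distrib_left)
    also have "\<dots> \<le> (1 + t) * l2_sq u + (1 + 1 / t) * (t\<^sup>2 * l2_sq w)"
    proof (intro add_mono mult_left_mono)
      have "(\<Sum>i<N. (cmod (u (i + n)))\<^sup>2) = (\<Sum>j\<in>(\<lambda>i. i + n) ` {..<N}. (cmod (u j))\<^sup>2)"
        by (subst sum.reindex) auto
      also have "\<dots> \<le> l2_sq u"
        by (intro sum_le_l2_sq u) simp
      finally show "(\<Sum>i<N. (cmod (u (i + n)))\<^sup>2) \<le> l2_sq u" .
      have "(real n)\<^sup>2 * (\<Sum>i<N. (cmod (lacunary_hankel c (n + i) w))\<^sup>2)
          \<le> (real n)\<^sup>2 * (4 * C * l2_sq w)"
        by (intro mult_left_mono lacunary_hankel_bound w n c C) simp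
      also have "\<dots> = ((2 * real n)\<^sup>2 * C) * l2_sq w"
        by (simp add: power_mult_distrib)
      also have "\<dots> \<le> t\<^sup>2 * l2_sq w"
        by (intro mult_right_mono Ct nonneg)
      finally show "(real n)\<^sup>2 * (\<Sum>i<N. (cmod (lacunary_hankel c (n + i) w))\<^sup>2) \<le> t\<^sup>2 * l2_sq w" .
    qed (use t in auto)
    also have "(1 + 1 / t) * (t\<^sup>2 * l2_sq w) = (t + t\<^sup>2) * l2_sq w"
      using t by (simp add: field_simps power2_eq_square)
    finally show ?thesis .
  qed
  have odd: "(\<Sum>i<N. (cmod (y (2 * i + 1)))\<^sup>2) \<le> l2_sq w" for N
  proof -
    have "(\<Sum>i<N. (cmod (y (2 * i + 1)))\<^sup>2) = (\<Sum>i\<in>{n..<N}. (cmod (w (i - n)))\<^sup>2)"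
      unfolding y_odd by (rule sum.mono_neutral_cong_right) auto
    also have "\<dots> = (\<Sum>j\<in>(\<lambda>i. i - n) ` {n..<N}. (cmod (w j))\<^sup>2)"
      by (subst sum.reindex) (auto simp: inj_on_def)
    also have "\<dots> \<le> l2_sq w"
      by (intro sum_le_l2_sq w) simp
    finally show ?thesis .
  qed
  have bound: "(\<Sum>m<N. (cmod (y m))\<^sup>2) \<le> (1 + t)\<^sup>2 * l2_sq x" for N
  proof -
    have "(\<Sum>m<N. (cmod (y m))\<^sup>2) \<le> (\<Sum>m<2 * N. (cmod (y m))\<^sup>2)"
      by (rule sum_mono2) auto
    also have "\<dots> \<le> (1 + t) * l2_sq u + (t + t\<^sup>2) * l2_sq w + l2_sq w"
      unfolding sum_even_odd by (intro add_mono even odd)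
    also have "\<dots> \<le> (1 + t)\<^sup>2 * l2_sq u + (1 + t)\<^sup>2 * l2_sq w"
    proof -
      have "(1 + t) * l2_sq u \<le> (1 + t)\<^sup>2 * l2_sq u"
        using t by (intro mult_right_mono nonneg) (simp add: power2_eq_square)
      moreover have "(t + t\<^sup>2 + 1) * l2_sq w \<le> (1 + t)\<^sup>2 * l2_sq w"
        using t by (intro mult_right_mono nonneg) (simp add: power2_eq_square algebra_simps)
      ultimately show ?thesis
        by (simp add: algebra_simps)
    qed
    finally show ?thesis
      by (simp add: split[symmetric] distrib_left)
  qed
  show "foguel_power c n x \<in> l2"
    using l2_boundedI(1)[OF bound] by (simp add: y_def)
  then show "hnorm l2_ip (foguel_power c n x) \<le> (1 + t) * hnorm l2_ip x"
    using real_sqrt_le_mono[OF l2_boundedI(2)[OF bound]] t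
    by (simp add: hnorm_l2 x y_def real_sqrt_mult)
qed

lemma foguel_bounded_operator:
  assumes c: "summable (\<lambda>k. (c k)\<^sup>2)"
  shows "bounded_operator pointwise_scale l2 l2_ip (foguel_power c 1)"
  unfolding bounded_operator_def
proof (intro conjI ballI allI)
  define C where "C = (\<Sum>k. (c k)\<^sup>2)"
  \<comment> \<open>The summand 1 only ensures that \<open>t\<close> is positive.\<close>
  define t where "t = sqrt (4 * C) + 1"
  have C0: "0 \<le> C"
    using c by (simp add: C_def suminf_nonneg)
  have C: "(\<Sum>k\<in>{k. k < K \<and> 1 \<le> 2 ^ k}. (c k)\<^sup>2) \<le> C" for K
    unfolding C_def using c by (intro sum_le_suminf) auto
  have t: "t > 0"
    using C0 by (simp add: t_def add_nonneg_pos)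
  have "(sqrt (4 * C))\<^sup>2 \<le> t\<^sup>2"
    unfolding t_def using C0 by (intro power_mono) auto
  then have Ct: "(2 * real 1)\<^sup>2 * C \<le> t\<^sup>2"
    using C0 by simp
  note bound = foguel_power_bound[where n = 1, OF _ _ c t C Ct]
  show "foguel_power c 1 x \<in> l2" if "x \<in> l2" for x
    using bound(1)[OF that] by simp
  show "\<exists>C. \<forall>x\<in>l2. hnorm l2_ip (foguel_power c 1 x) \<le> C * hnorm l2_ip x"
    using bound(2) by blast
  show "foguel_power c 1 (x + y) = foguel_power c 1 x + foguel_power c 1 y"
    if "x \<in> l2" "y \<in> l2" for x y
    using lacunary_hankel_add[OF c l2_even_odd(2)[OF that(1)] l2_even_odd(2)[OF that(2)]]
    by (auto simp: foguel_power_def fun_eq_iff algebra_simps)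
  show "foguel_power c 1 (pointwise_scale r x) = pointwise_scale r (foguel_power c 1 x)"
    if "x \<in> l2" for r x
    using lacunary_hankel_scale[OF c l2_even_odd(2)[OF that]]
    by (auto simp: foguel_power_def pointwise_scale_def fun_eq_iff algebra_simps)
qed

definition unit_vector :: "nat \<Rightarrow> nat \<Rightarrow> complex" where
  "unit_vector i = (\<lambda>m. if m = i then 1 else 0)"

lemma unit_vector_in_l2: "unit_vector i \<in> l2"
  unfolding l2_def mem_Collect_eq
  by (rule summable_finite[of "{i}"]) (auto simp: unit_vector_def)

text \<open>
  The index \<open>1\<close> is the first coordinate of the second summand and \<open>0\<close> the first coordinate of the first
  summand, so these are the upper left entries \<open>n \<Gamma>\<^bsub>n-1,0\<^esub>\<close> of the corners.
\<close>
lemma foguel_power_unit_vector: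
  "foguel_power c (2 ^ k) (unit_vector 1) 0 = 2 ^ k * of_real (c k)"
  "(\<And>k. n \<noteq> 2 ^ k) \<Longrightarrow> foguel_power c n (unit_vector 1) 0 = 0"
proof -
  have shift: "unit_vector 1 (0 + 2 * n) = 0" for n
    by (simp add: unit_vector_def)
  have "lacunary_hankel c (2 ^ k + 0 div 2) (\<lambda>j. unit_vector 1 (2 * j + 1)) = of_real (c k)"
    unfolding lacunary_hankel_def
    by (subst suminf_finite[of "{k}"]) (auto simp: unit_vector_def)
  then show "foguel_power c (2 ^ k) (unit_vector 1) 0 = 2 ^ k * of_real (c k)"
    unfolding foguel_power_def shift by simp
next
  assume n: "\<And>k. n \<noteq> 2 ^ k"
  have "(if n \<le> 2 ^ j then complex_of_real (c j) * unit_vector 1 (2 * (2 ^ j - n) + 1) else 0) = 0" for j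
    using n[of j] by (auto simp: unit_vector_def)
  then have "lacunary_hankel c n (\<lambda>j. unit_vector 1 (2 * j + 1)) = 0"
    unfolding lacunary_hankel_def by (simp only: suminf_zero)
  then show "foguel_power c n (unit_vector 1) 0 = 0"
    by (simp add: foguel_power_def unit_vector_def)
qed

text \<open>
  The coefficients \<open>2^k c\<^sub>k\<close> of the derivative of the symbol are the values to which the lacunary
  estimate applies. Testing it with these values, normalised in the Euclidean norm, bounds their
  partial sums of squares.
\<close>
lemma foguel_not_similar_to_contraction:
  assumes c: "summable (\<lambda>k. (c k)\<^sup>2)" and diverges: "\<not> summable (\<lambda>k. (2 ^ k * c k)\<^sup>2)"
  shows "\<not> similar_to_contraction pointwise_scale l2 l2_ip (foguel_power c 1)"
proof
  assume similar: "similar_to_contraction pointwise_scale l2 l2_ip (foguel_power c 1)"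
  obtain C where C: "\<And>a K. (\<Sum>k<K. (a k)\<^sup>2) \<le> 1 \<Longrightarrow>
      cmod (\<Sum>k<K. of_real (a k) * (foguel_power c 1 ^^ (2 ^ k)) (unit_vector 1) 0) \<le> C"
  proof (rule l2.lacunary_estimate[OF foguel_bounded_operator[OF c] similar unit_vector_in_l2[of 1],
        of "\<lambda>x. x 0"])
    show "cmod (x 0) \<le> hnorm l2_ip x" if "x \<in> l2" for x
      using that by (rule cmod_le_l2)
    show "(foguel_power c 1 ^^ m) (unit_vector 1) 0 = 0" if "\<And>k. m \<noteq> 2 ^ k" for m
      unfolding funpow_foguel using that by (rule foguel_power_unit_vector(2))
  qed (auto simp: pointwise_scale_def)
  define s where "s k = 2 ^ k * c k" for k
  have "(\<Sum>k<K. (s k)\<^sup>2) \<le> \<bar>C\<bar>\<^sup>2" for K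
  proof (cases "(\<Sum>k<K. (s k)\<^sup>2) = 0")
    case False
    define \<sigma> where "\<sigma> = (\<Sum>k<K. (s k)\<^sup>2)"
    have \<sigma>: "\<sigma> > 0"
      using False sum_nonneg[of "{..<K}" "\<lambda>k. (s k)\<^sup>2"] by (simp add: \<sigma>_def)
    \<comment> \<open>The extremal choice in the Cauchy-Schwarz inequality.\<close>
    define a where "a k = s k / sqrt \<sigma>" for k
    have "(\<Sum>k<K. (a k)\<^sup>2) = 1"
      using \<sigma> by (simp add: a_def power_divide sum_divide_distrib[symmetric] \<sigma>_def[symmetric])
    then have "cmod (\<Sum>k<K. of_real (a k) * (foguel_power c 1 ^^ (2 ^ k)) (unit_vector 1) 0) \<le> C"
      by (intro C) simp
    also have "(\<Sum>k<K. of_real (a k) * (foguel_power c 1 ^^ (2 ^ k)) (unit_vector 1) 0)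
        = of_real (\<Sum>k<K. a k * s k)"
      by (simp only: funpow_foguel foguel_power_unit_vector(1)) (simp add: s_def)
    also have "(\<Sum>k<K. a k * s k) = \<sigma> / sqrt \<sigma>"
      by (simp add: a_def \<sigma>_def power2_eq_square sum_divide_distrib)
    also have "\<dots> = sqrt \<sigma>"
      using \<sigma> by (simp add: real_div_sqrt)
    finally have "sqrt \<sigma> \<le> \<bar>C\<bar>"
      using \<sigma> by simp
    then show ?thesis
      unfolding \<sigma>_def[symmetric] using sqrt_le_D by blast
  qed simp
  then have "summable (\<lambda>k. (s k)\<^sup>2)"
    by (intro summableI_nonneg_bounded[of _ "\<bar>C\<bar>\<^sup>2"]) auto
  with diverges show False
    by (simp add: s_def)
qed

section \<open>Choice of the coefficients\<close>

text \<open>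
  Cauchy condensation for \<open>b n = \<beta> n / n\<^sup>2\<close>: on the block from \<open>2^k\<close> to \<open>2^(k+1)\<close> there are \<open>2^k\<close> terms
  \<open>n b n\<close>, each at most \<open>2 * 2^k b (2^k)\<close>.
\<close>
lemma dyadic_condensation_bound:
  fixes b :: "nat \<Rightarrow> real"
  assumes b: "\<And>m n. 1 \<le> m \<Longrightarrow> m \<le> n \<Longrightarrow> b n \<le> b m" and pos: "\<And>n. n \<ge> 1 \<Longrightarrow> 0 \<le> b n"
  shows "(\<Sum>n\<in>{1..<2 ^ K}. real n * b n) \<le> 2 * (\<Sum>k<K. 4 ^ k * b (2 ^ k))"
proof (induction K)
  case (Suc K)
  have "(\<Sum>n\<in>{2 ^ K..<2 ^ Suc K}. real n * b n) \<le> (\<Sum>n\<in>{2 ^ K..<2 ^ Suc K :: nat}. 2 * 2 ^ K * b (2 ^ K))"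
  proof (rule sum_mono)
    fix n :: nat assume n: "n \<in> {2 ^ K..<2 ^ Suc K}"
    then have "real n \<le> real (2 * 2 ^ K)"
      by (subst of_nat_le_iff) simp
    moreover have "1 \<le> n"
      using n one_le_power[of "2::nat" K] by (auto simp del: one_le_power)
    ultimately show "real n * b n \<le> 2 * 2 ^ K * b (2 ^ K)"
      using n by (intro mult_mono b pos) auto
  qed
  also have "\<dots> = 2 * (4 ^ K * b (2 ^ K))"
    by (simp add: power_mult_distrib[symmetric] flip: mult.assoc)
  finally have "(\<Sum>n\<in>{2 ^ K..<2 ^ Suc K}. real n * b n) \<le> 2 * (4 ^ K * b (2 ^ K))" .
  moreover have "(\<Sum>n\<in>{1..<2 ^ Suc K}. real n * b n)
      = (\<Sum>n\<in>{1..<2 ^ K}. real n * b n) + (\<Sum>n\<in>{2 ^ K..<2 ^ Suc K}. real n * b n)"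
    by (subst sum.atLeastLessThan_concat) auto
  ultimately show ?case
    using Suc by simp
qed simp

theorem theorem1p3:
  fixes \<beta> :: "nat \<Rightarrow> real"
  assumes "\<And>n. n \<ge> 1 \<Longrightarrow> \<beta> n > 0"
    and "\<beta> \<longlonglongrightarrow> 0"
    and "filterlim (\<lambda>N. \<Sum>n=1..N. \<beta> n / real n) at_top sequentially"
    and "antimono_on {1..} (\<lambda>n. \<beta> n / (real n)\<^sup>2)"
  shows "\<exists>(scale :: complex \<Rightarrow> (nat \<Rightarrow> complex) \<Rightarrow> (nat \<Rightarrow> complex)) H ip F.
           complex_hilbert_space scale H ip \<and>
           bounded_operator scale H ip F \<and>
           (\<forall>n\<ge>1. operator_norm H ip (F ^^ n) \<le> 1 + sqrt (\<beta> n)) \<and>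
           \<not> similar_to_contraction scale H ip F"
proof -
  define b where "b n = \<beta> n / (real n)\<^sup>2" for n
  define g where "g k = b (2 ^ k)" for k
  \<comment> \<open>The squares telescope, which bounds tails by \<open>b n / 4\<close> even where \<open>b\<close> is nearly constant.\<close>
  define c where "c k = sqrt (g k - g (Suc k)) / 2" for k
  have b_pos: "b n > 0" if "n \<ge> 1" for n
    using assms(1)[OF that] that by (simp add: b_def)
  have b_anti: "b n \<le> b m" if "1 \<le> m" "m \<le> n" for m n
    using monotone_onD[OF assms(4), of m n] that by (simp add: b_def)
  have g_pos: "g k > 0" and g_anti: "g (Suc k) \<le> g k" for k
    by (simp_all add: g_def b_pos b_anti)
  have c_sq: "(c k)\<^sup>2 = (g k - g (Suc k)) / 4" for k
    using g_anti[of k] by (simp add: c_def power_divide)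
  have g_\<beta>: "4 ^ k * g k = \<beta> (2 ^ k)" for k
    by (simp add: g_def b_def power2_eq_square power_mult_distrib[symmetric])
  have tail: "(\<Sum>k\<in>{k. k < K \<and> n \<le> 2 ^ k}. (c k)\<^sup>2) \<le> b n / 4" if n: "n \<ge> 1" for n K
  proof -
    have "\<exists>k. n \<le> 2 ^ k"
      using less_exp[of n] by (intro exI[of _ n]) simp
    define k0 where "k0 = (LEAST k. n \<le> 2 ^ k)"
    have k0: "n \<le> 2 ^ k0"
      unfolding k0_def using \<open>\<exists>k. n \<le> 2 ^ k\<close> by (rule LeastI_ex)
    have "k0 \<le> k" if "n \<le> 2 ^ k" for k
      unfolding k0_def using that by (rule Least_le)
    then have "(\<Sum>k\<in>{k. k < K \<and> n \<le> 2 ^ k}. (c k)\<^sup>2) \<le> (\<Sum>k\<in>{k0..<max k0 K}. (c k)\<^sup>2)"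
      by (intro sum_mono2) auto
    also have "\<dots> = (\<Sum>k\<in>{k0..<max k0 K}. g k - g (Suc k)) / 4"
      by (simp add: c_sq sum_divide_distrib)
    also have "\<dots> = (g k0 - g (max k0 K)) / 4"
      using sum_Suc_diff'[of k0 "max k0 K" "\<lambda>k. - g k"] by simp
    also have "\<dots> \<le> g k0 / 4"
      using g_pos[of "max k0 K"] by simp
    also have "\<dots> \<le> b n / 4"
      using b_anti[OF n k0] by (simp add: g_def)
    finally show ?thesis .
  qed
  have c: "summable (\<lambda>k. (c k)\<^sup>2)"
  proof (rule bounded_imp_summable)
    show "(\<Sum>k\<le>K. (c k)\<^sup>2) \<le> b 1 / 4" for K
    proof -
      have "{k. k < Suc K \<and> 1 \<le> (2::nat) ^ k} = {..K}"
        by auto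
      then show ?thesis
        using tail[of 1 "Suc K"] by simp
    qed
  qed simp
  have "\<not> summable (\<lambda>k. (2 ^ k * c k)\<^sup>2)"
  proof
    assume s: "summable (\<lambda>k. (2 ^ k * c k)\<^sup>2)"
    obtain B where B: "\<And>n. \<bar>\<beta> n\<bar> \<le> B"
      using convergent_imp_Bseq[OF convergentI[OF assms(2)]] by (auto simp: Bseq_def)
    define A where "A = (\<Sum>k. (2 ^ k * c k)\<^sup>2)"
    have sq: "(2 ^ k * c k)\<^sup>2 = \<beta> (2 ^ k) / 4 - \<beta> (2 ^ Suc k) / 16" for k
    proof -
      have "((2::real) ^ k)\<^sup>2 = 4 ^ k"
        by (simp add: power2_eq_square flip: power_mult_distrib)
      then have "(2 ^ k * c k)\<^sup>2 = 4 ^ k * ((g k - g (Suc k)) / 4)"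
        by (simp only: power_mult_distrib c_sq)
      also have "\<dots> = (4 ^ k * g k) / 4 - (4 ^ Suc k * g (Suc k)) / 16"
        by (simp add: right_diff_distrib diff_divide_distrib)
      finally show ?thesis
        unfolding g_\<beta> .
    qed
    \<comment> \<open>Each \<open>\<beta> (2^k)\<close> with \<open>0 < k < K\<close> occurs with the factor \<open>1/4 - 1/16 = 3/16\<close>.\<close>
    have partial: "(3 / 16) * (\<Sum>k<K. \<beta> (2 ^ k)) \<le> A + B" for K
    proof -
      have "(\<Sum>k<K. (2 ^ k * c k)\<^sup>2) = (3 / 16) * (\<Sum>k<K. \<beta> (2 ^ k)) + (\<beta> 1 - \<beta> (2 ^ K)) / 16"
        unfolding sq by (induction K) (simp_all add: field_simps)
      moreover have "(\<Sum>k<K. (2 ^ k * c k)\<^sup>2) \<le> A"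
        unfolding A_def using s by (intro sum_le_suminf) auto
      ultimately show ?thesis
        using B[of 1] B[of "2 ^ K"] assms(1)[of 1] assms(1)[of "2 ^ K"] by (simp add: field_simps)
    qed
    have "eventually (\<lambda>N. (\<Sum>n=1..N. \<beta> n / real n) > 2 * ((16 / 3) * (A + B))) sequentially"
      using assms(3) unfolding filterlim_at_top_dense by blast
    then obtain N where N: "(\<Sum>n=1..N. \<beta> n / real n) > 2 * ((16 / 3) * (A + B))"
      unfolding eventually_sequentially by blast
    have "(\<Sum>n=1..N. \<beta> n / real n) = (\<Sum>n=1..N. real n * b n)"
      by (rule sum.cong) (auto simp: b_def power2_eq_square)
    also have "\<dots> \<le> (\<Sum>n\<in>{1..<2 ^ N}. real n * b n)"
    proof (rule sum_mono2)
      show "{1..N} \<subseteq> {1..<2 ^ N}"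
        using le_less_trans[OF _ less_exp[of N]] by auto
    qed (use b_pos in \<open>auto intro!: mult_nonneg_nonneg less_imp_le\<close>)
    also have "\<dots> \<le> 2 * (\<Sum>k<N. 4 ^ k * b (2 ^ k))"
      using b_pos by (intro dyadic_condensation_bound b_anti) (auto intro: less_imp_le)
    also have "(\<Sum>k<N. 4 ^ k * b (2 ^ k)) = (\<Sum>k<N. \<beta> (2 ^ k))"
      by (simp add: g_\<beta>[symmetric] g_def)
    finally show False
      using N partial[of N] by simp
  qed
  then have not_similar: "\<not> similar_to_contraction pointwise_scale l2 l2_ip (foguel_power c 1)"
    by (rule foguel_not_similar_to_contraction[OF c])
  have growth: "operator_norm l2 l2_ip (foguel_power c 1 ^^ n) \<le> 1 + sqrt (\<beta> n)" if n: "n \<ge> 1" for n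
    unfolding operator_norm_def
  proof (rule cSUP_least)
    show "{x \<in> l2. hnorm l2_ip x \<le> 1} \<noteq> {}"
      using l2.zero_in_H l2.ip_zero by (auto simp: hnorm_def intro!: exI[of _ 0])
    fix x assume x: "x \<in> {x \<in> l2. hnorm l2_ip x \<le> 1}"
    have t: "sqrt (\<beta> n) > 0"
      using assms(1)[OF n] by simp
    have "(2 * real n)\<^sup>2 * (b n / 4) \<le> (sqrt (\<beta> n))\<^sup>2"
      using assms(1)[OF n] n by (simp add: b_def power_mult_distrib)
    then have "hnorm l2_ip (foguel_power c n x) \<le> (1 + sqrt (\<beta> n)) * hnorm l2_ip x"
      using x n by (intro foguel_power_bound(2)[OF _ n c t tail]) auto
    also have "\<dots> \<le> (1 + sqrt (\<beta> n)) * 1"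
      using x t by (intro mult_left_mono) auto
    finally show "hnorm l2_ip ((foguel_power c 1 ^^ n) x) \<le> 1 + sqrt (\<beta> n)"
      by (simp only: funpow_foguel mult_1_right)
  qed
  show ?thesis
    using l2.complex_hilbert_space_axioms foguel_bounded_operator[OF c] growth not_similar by blast
qed

end
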